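(* Suppose all agents have identical uncertainty classes: $\epsilon_{0,k}=\epsilon_0$ and $\epsilon_{1,k}=\epsilon_1$ for all $k\ge1$. For each $N$, let the decision rules $\phi^{(N)}=(\phi_1,\dots,\phi_N)$ of the agents in a tandem of length $N$ be chosen so as to minimize $P_N^{\mathrm{DD}}(\phi^{(N)})$. Then $P_N^{\mathrm{DD}}(\phi^{(N)})\to0$ as $N\to\infty$ if and only if at least one of the following is true: 1) $\epsilon_0=0$ and the log-likelihood ratio of $P_1^*$ versus $P_0^*$ is unbounded from above; 2) $\epsilon_1=0$ and the log-likelihood ratio of $P_1^*$ versus $P_0^*$ is unbounded from below.
   Context: Tandem network: agents $1,\dots,N$; the true hypothesis $H$ is $H_i$ with prior probability $\pi_i\in(0,1)$, $i=0,1$, $\pi_0+\pi_1=1$. Conditioned on $H=H_i$, agent $k$ observes $Y_k$ in a measurable space $(\mathcal{Y},\mathcal{A})$ with (unknown) distribution $P_{i,k}$ in the uncertainty class $\mathcal{P}_{i,k}=\{(1-\epsilon_{i,k})P_i^*+\epsilon_{i,k}R : R\in\mathcal{R}\}$, where $\mathcal{R}$ is the set of all probability measures on $(\mathcal{Y},\mathcal{A})$, $P_i^*\in\mathcal{R}$ is the nominal distribution (the same for all agents), and the contamination $\epsilon_{i,k}\in[0,1)$ is small enough that $\mathcal{P}_{0,k}$ and $\mathcal{P}_{1,k}$ are disjoint. All distributions in $\mathcal{P}_{0,k}$ and $\mathcal{P}_{1,k}$ are assumed absolutely continuous with respect to one another. Given $H$, the observations are independent across agents. Agent $k$ decides $U_k=\phi_k(Y_k,U_{k-1})\in\{0,1\}$,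 with $U_0\equiv 0$, where $\phi_k$ is its decision rule. $\mathcal{P}_i^{(N)}=\mathcal{P}_{i,1}\times\cdots\times\mathcal{P}_{i,N}$; an element $P_i^{(N)}=P_{i,1}\times\cdots\times P_{i,N}$ is the product law of $(Y_1,\dots,Y_N)$ under $H_i$. $P_{e,N}(\phi^{(N)},P_0^{(N)},P_1^{(N)})=\pi_0P_0^{(N)}(U_N=1)+\pi_1P_1^{(N)}(U_N=0)$, and $P_N^{\mathrm{DD}}(\phi^{(N)})=\sup_{(P_0^{(N)},P_1^{(N)})\in\mathcal{P}_0^{(N)}\times\mathcal{P}_1^{(N)}}P_{e,N}(\phi^{(N)},P_0^{(N)},P_1^{(N)})$. The log-likelihood ratio of $P_1^*$ versus $P_0^*$ is $\log(p_1^*/p_0^* )$ with $p_i^*$ the density of $P_i^*$ with respect to a common measure; boundedness is understood up to null sets. *)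

theory Defs
  imports "HOL-Probability.Probability"
begin

text \<open>The class of all mixtures \<open>(1 - e) P + e R\<close> with \<open>R\<close> a probability measure on \<open>M\<close>, i.e. an
  element of \<open>space (prob_algebra M)\<close>; a mixture is given by its values on the measurable sets,
  which determine it.\<close>
definition contamination_class :: "'y measure \<Rightarrow> real \<Rightarrow> 'y measure \<Rightarrow> 'y measure set" where
  "contamination_class M e P =
     {Q \<in> space (prob_algebra M). \<exists>R \<in> space (prob_algebra M).
        \<forall>A \<in> sets M. measure Q A = (1 - e) * measure P A + e * measure R A}"

definition uncertainty_product ::
    "'y measure \<Rightarrow> (nat \<Rightarrow> real) \<Rightarrow> 'y measure \<Rightarrow> nat \<Rightarrow> (nat \<Rightarrow> 'y measure) set" where
  "uncertainty_product M eps P N = (\<Pi>\<^sub>E k \<in> {1..N}. contamination_class M (eps k) P)"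

text \<open>Decisions \<open>0\<close> and \<open>1\<close> are \<open>False\<close> and \<open>True\<close>; \<open>\<phi> k y u\<close> is the decision of agent \<open>k\<close>
  who observes \<open>y\<close> and receives \<open>u\<close> from agent \<open>k - 1\<close>.\<close>
definition decision_rules :: "'y measure \<Rightarrow> nat \<Rightarrow> (nat \<Rightarrow> 'y \<Rightarrow> bool \<Rightarrow> bool) \<Rightarrow> bool" where
  "decision_rules M N \<phi> \<longleftrightarrow>
     (\<forall>k \<in> {1..N}. case_prod (\<phi> k) \<in> M \<Otimes>\<^sub>M count_space UNIV \<rightarrow>\<^sub>M count_space UNIV)"

primrec decision :: "(nat \<Rightarrow> 'y \<Rightarrow> bool \<Rightarrow> bool) \<Rightarrow> nat \<Rightarrow> (nat \<Rightarrow> 'y) \<Rightarrow> bool" where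
  "decision \<phi> 0 y = False"
| "decision \<phi> (Suc k) y = \<phi> (Suc k) (y (Suc k)) (decision \<phi> k y)"

definition error_prob ::
    "real \<Rightarrow> real \<Rightarrow> nat \<Rightarrow> (nat \<Rightarrow> 'y \<Rightarrow> bool \<Rightarrow> bool) \<Rightarrow>
       (nat \<Rightarrow> 'y measure) \<Rightarrow> (nat \<Rightarrow> 'y measure) \<Rightarrow> real" where
  "error_prob \<pi>0 \<pi>1 N \<phi> P0 P1 =
     \<pi>0 * measure (PiM {1..N} P0) {y \<in> space (PiM {1..N} P0). decision \<phi> N y} +
     \<pi>1 * measure (PiM {1..N} P1) {y \<in> space (PiM {1..N} P1). \<not> decision \<phi> N y}"

text \<open>The supremum of reals is genuine: the classes contain \<open>P0\<close> and \<open>P1\<close>, and error probabilities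
  lie in \<open>[0, 1]\<close>.\<close>
definition worst_error ::
    "'y measure \<Rightarrow> real \<Rightarrow> real \<Rightarrow> (nat \<Rightarrow> real) \<Rightarrow> (nat \<Rightarrow> real) \<Rightarrow> 'y measure \<Rightarrow> 'y measure \<Rightarrow>
       nat \<Rightarrow> (nat \<Rightarrow> 'y \<Rightarrow> bool \<Rightarrow> bool) \<Rightarrow> real" where
  "worst_error M \<pi>0 \<pi>1 eps0 eps1 P0 P1 N \<phi> =
     (SUP (Q0, Q1) \<in> uncertainty_product M eps0 P0 N \<times> uncertainty_product M eps1 P1 N.
        error_prob \<pi>0 \<pi>1 N \<phi> Q0 Q1)"

text \<open>Only meaningful where both densities are positive, which holds almost everywhere with
  respect to the two (mutually absolutely continuous) distributions, but in general not with
  respect to the dominating measure. Boundedness is therefore understood up to null sets of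
  the distributions.\<close>
definition log_likelihood_ratio :: "('y \<Rightarrow> real) \<Rightarrow> ('y \<Rightarrow> real) \<Rightarrow> 'y \<Rightarrow> real" where
  "log_likelihood_ratio p1 p0 y = ln (p1 y / p0 y)"

definition ess_unbounded_above :: "'y measure \<Rightarrow> ('y \<Rightarrow> real) \<Rightarrow> bool" where
  "ess_unbounded_above P f \<longleftrightarrow> \<not> (\<exists>c. AE y in P. f y \<le> c)"

definition ess_unbounded_below :: "'y measure \<Rightarrow> ('y \<Rightarrow> real) \<Rightarrow> bool" where
  "ess_unbounded_below P f \<longleftrightarrow> \<not> (\<exists>c. AE y in P. c \<le> f y)"

end

theory Submission imports Defs begin

text \<open>If one of the conditions holds, there are events \<open>A\<close> of arbitrarily small probability under the
  uncontaminated hypothesis whose probability under the other one is larger by an arbitrarily large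
  factor. Letting about \<open>\<delta> / P A\<close> agents raise an alarm on \<open>A\<close>, and the rest pass it on, makes both
  error probabilities small.

  Otherwise \<open>Q0 = (1 - e0) P0 + e0 P1\<close> and \<open>Q1 = (1 - e1) P1 + e1 P0\<close> dominate each other up to a
  constant factor \<open>C > 1\<close>, and it suffices to consider this one pair. Let \<open>x\<close> and \<open>y\<close> be the
  two error probabilities of an agent. Although they may be traded against each other, the
  bounds \<open>1 / (C + 1) \<le> x + y \<le> 2 - 1 / (C + 1)\<close> propagate from agent to agent.\<close>

section \<open>Measurability of decisions and the law of a single message\<close>

lemma measurable_decision:
  assumes "decision_rules M N \<phi>" "m \<le> N" "m \<le> n" "\<And>k. k \<in> {1..n} \<Longrightarrow> sets (Q k) = sets M"
  shows "decision \<phi> m \<in> PiM {1..n} Q \<rightarrow>\<^sub>M count_space UNIV"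
  using assms(2,3)
proof (induction m)
  case 0
  then show ?case by simp
next
  case (Suc m)
  have "(\<lambda>y. y (Suc m)) \<in> PiM {1..n} Q \<rightarrow>\<^sub>M Q (Suc m)"
    using Suc.prems by (intro measurable_component_singleton) auto
  then have "(\<lambda>y. y (Suc m)) \<in> PiM {1..n} Q \<rightarrow>\<^sub>M M"
    using assms(4)[of "Suc m"] Suc.prems by (simp cong: measurable_cong_sets)
  moreover have "decision \<phi> m \<in> PiM {1..n} Q \<rightarrow>\<^sub>M count_space UNIV"
    using Suc by simp
  ultimately have
    "(\<lambda>y. (y (Suc m), decision \<phi> m y)) \<in> PiM {1..n} Q \<rightarrow>\<^sub>M M \<Otimes>\<^sub>M count_space UNIV"
    by (rule measurable_Pair)
  moreover have "case_prod (\<phi> (Suc m)) \<in> M \<Otimes>\<^sub>M count_space UNIV \<rightarrow>\<^sub>M count_space UNIV"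
    using assms(1) Suc.prems by (simp add: decision_rules_def)
  ultimately have "(\<lambda>y. case_prod (\<phi> (Suc m)) (y (Suc m), decision \<phi> m y))
      \<in> PiM {1..n} Q \<rightarrow>\<^sub>M count_space UNIV"
    by (rule measurable_compose)
  then show ?case by simp
qed

lemma decision_cong:
  "(\<And>k. k \<in> {1..n} \<Longrightarrow> x k = y k) \<Longrightarrow> decision \<phi> n x = decision \<phi> n y"
  by (induction n) auto

lemma measurable_decision_rule:
  assumes "decision_rules M N \<phi>" "k \<in> {1..N}"
  shows "{y \<in> space M. \<phi> k y u} \<in> sets M"
proof -
  have "case_prod (\<phi> k) \<in> M \<Otimes>\<^sub>M count_space UNIV \<rightarrow>\<^sub>M count_space UNIV"
    using assms by (simp add: decision_rules_def)
  from measurable_compose[OF measurable_Pair2' this, of u]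
  have "(\<lambda>y. \<phi> k y u) \<in> M \<rightarrow>\<^sub>M count_space UNIV" by simp
  then show ?thesis by simp
qed

text \<open>Fubini in the last coordinate: updating coordinate \<open>Suc n\<close> leaves the
  decision of the first \<open>n\<close> agents unchanged, so the inner integral is \<open>a\<close>
  at the incoming message. All agents share one law \<open>Q\<close> here, since the lower bound
  will use a single pair of distributions.\<close>

lemma prob_decision_Suc:
  assumes rules: "decision_rules M N \<phi>" and n: "Suc n \<le> N" and Q: "Q \<in> space (prob_algebra M)"
  defines "x \<equiv> \<lambda>m. measure (PiM {1..m} (\<lambda>_. Q)) {y \<in> space (PiM {1..m} (\<lambda>_. Q)). decision \<phi> m y}"
  defines "a \<equiv> \<lambda>u. measure Q {y \<in> space M. \<phi> (Suc n) y u}"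
  shows "x (Suc n) = (1 - x n) * a False + x n * a True"
proof -
  have sQ: "sets Q = sets M" and pQ: "prob_space Q"
    using Q by (auto simp: space_prob_algebra)
  have spQ: "space Q = space M" using sQ by (rule sets_eq_imp_space_eq)
  interpret Q: prob_space Q by fact
  interpret product_prob_space "\<lambda>_::nat. Q" by unfold_locales
  interpret PP: prob_space "PiM {1..m} (\<lambda>_. Q)" for m :: nat by (rule prob_space_PiM) (rule pQ)
  let ?P = "\<lambda>m. PiM {1..m} (\<lambda>_. Q)"
  let ?D = "\<lambda>m. {y \<in> space (?P m). decision \<phi> m y}"
  have dm[measurable]: "decision \<phi> m \<in> ?P m \<rightarrow>\<^sub>M count_space UNIV" if "m \<le> N" for m
    using that sQ by (intro measurable_decision[OF rules]) auto
  have D: "?D m \<in> sets (?P m)" if "m \<le> N" for m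
    using dm[OF that] by simp
  have A: "{y \<in> space Q. \<phi> (Suc n) y u} \<in> sets Q" for u
    using measurable_decision_rule[OF rules, of "Suc n"] n by (simp add: spQ sQ)
  have bounds: "0 \<le> x m" "x m \<le> 1" "0 \<le> a u" for m u
    using PP.prob_le_1 by (simp_all add: x_def a_def)
  have ins: "{1..Suc n} = insert (Suc n) {1..n}" by auto
  have "emeasure (?P (Suc n)) (?D (Suc n)) = (\<integral>\<^sup>+z. indicator (?D (Suc n)) z \<partial>?P (Suc n))"
    using D[of "Suc n"] n by simp
  also have "\<dots> = (\<integral>\<^sup>+z. (\<integral>\<^sup>+y. indicator (?D (Suc n)) (z(Suc n := y)) \<partial>Q) \<partial>?P n)"
    using D[of "Suc n"] n unfolding ins
    by (intro product_nn_integral_insert) (auto simp: ins)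
  also have "\<dots> = (\<integral>\<^sup>+z. ennreal (a False) * indicator (space (?P n) - ?D n) z
                       + ennreal (a True) * indicator (?D n) z \<partial>?P n)"
  proof (rule nn_integral_cong)
    fix z assume z: "z \<in> space (?P n)"
    have "(\<integral>\<^sup>+y. indicator (?D (Suc n)) (z(Suc n := y)) \<partial>Q)
        = (\<integral>\<^sup>+y. indicator {y \<in> space Q. \<phi> (Suc n) y (decision \<phi> n z)} y \<partial>Q)"
    proof (rule nn_integral_cong)
      fix y assume y: "y \<in> space Q"
      have "z(Suc n := y) \<in> space (?P (Suc n))"
        using z y by (auto simp: space_PiM PiE_iff extensional_def)
      moreover have "decision \<phi> n (z(Suc n := y)) = decision \<phi> n z"
        by (rule decision_cong) auto
      ultimately show "indicator (?D (Suc n)) (z(Suc n := y))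
          = (indicator {y \<in> space Q. \<phi> (Suc n) y (decision \<phi> n z)} y :: ennreal)"
        using y by (auto simp: indicator_def)
    qed
    also have "\<dots> = ennreal (a (decision \<phi> n z))"
      using A by (simp add: a_def spQ Q.emeasure_eq_measure)
    finally show "(\<integral>\<^sup>+y. indicator (?D (Suc n)) (z(Suc n := y)) \<partial>Q)
        = ennreal (a False) * indicator (space (?P n) - ?D n) z + ennreal (a True) * indicator (?D n) z"
      using z by (cases "decision \<phi> n z") auto
  qed
  also have "\<dots> = ennreal (a False) * emeasure (?P n) (space (?P n) - ?D n)
                + ennreal (a True) * emeasure (?P n) (?D n)"
    using D[of n] n by (subst nn_integral_add) (auto simp: nn_integral_cmult_indicator)
  also have "emeasure (?P n) (space (?P n) - ?D n) = ennreal (1 - x n)"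
    using PP.prob_compl[OF D[of n]] n by (simp add: PP.emeasure_eq_measure x_def del: One_nat_def)
  also have "emeasure (?P n) (?D n) = ennreal (x n)"
    by (simp add: PP.emeasure_eq_measure x_def del: One_nat_def)
  also have "ennreal (a False) * ennreal (1 - x n) + ennreal (a True) * ennreal (x n)
      = ennreal ((1 - x n) * a False + x n * a True)"
    using bounds by (simp add: ennreal_mult mult.commute)
  finally have "ennreal (x (Suc n)) = ennreal ((1 - x n) * a False + x n * a True)"
    by (simp add: PP.emeasure_eq_measure x_def del: One_nat_def)
  then show ?thesis
    using bounds by (subst (asm) ennreal_inj) simp_all
qed

section \<open>Lower bound for the error sum under a bounded likelihood ratio\<close>

text \<open>Linear programming: the feasible points \<open>(a, b)\<close> have the extreme points \<open>(0, 0)\<close>, \<open>(1, 1)\<close>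
  and \<open>(1 / (C + 1), C / (C + 1))\<close> on the side that matters.\<close>
lemma likelihood_ratio_test_bound:
  fixes a b s t C :: real
  assumes "1 < C" "0 \<le> a" "b \<le> 1" "0 \<le> s" "0 \<le> t" "b \<le> C * a" "1 - a \<le> C * (1 - b)"
  shows "min (min s t) ((s + t) / (C + 1)) \<le> s * a + t * (1 - b)"
proof -
  \<comment> \<open>The cases tell which extreme point minimizes the objective:
    \<open>(0, 0)\<close> with value \<open>t\<close>, \<open>(1, 1)\<close> with value
    \<open>s\<close>, or the third one with value \<open>(s + t) / (C + 1)\<close>.\<close>
  consider "C * t \<le> s" | "C * s \<le> t" | "t < C * s" "s < C * t" by linarith
  then show ?thesis
  proof cases
    case 1
    have "t * b \<le> t * (C * a)" using assms by (intro mult_left_mono) auto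
    also have "\<dots> \<le> s * a" using mult_right_mono[OF 1 assms(2)] by (simp add: ac_simps)
    finally have "t \<le> s * a + t * (1 - b)" by (simp add: algebra_simps)
    then show ?thesis by linarith
  next
    case 2
    have "s * (1 - a) \<le> s * (C * (1 - b))" using assms by (intro mult_left_mono) auto
    also have "\<dots> \<le> t * (1 - b)"
      using mult_right_mono[OF 2, of "1 - b"] assms by (simp add: ac_simps)
    finally have "s \<le> s * a + t * (1 - b)" by (simp add: algebra_simps)
    then show ?thesis by linarith
  next
    case 3
    \<comment> \<open>\<open>C * s - t\<close> and \<open>C * t - s\<close> are dual multipliers: in
      the sum of the two inequalities \<open>a\<close> gets the coefficient
      \<open>(C\<^sup>2 - 1) * s\<close> and \<open>1 - b\<close> gets
      \<open>(C\<^sup>2 - 1) * t\<close>.\<close>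
    have "(C * s - t) * 1 \<le> (C * s - t) * (C * a + (1 - b))"
      using 3 assms by (intro mult_left_mono) auto
    moreover have "(C * t - s) * 1 \<le> (C * t - s) * (a + C * (1 - b))"
      using 3 assms by (intro mult_left_mono) auto
    ultimately have "(C - 1) * (s + t) \<le> (C - 1) * ((C + 1) * (s * a + t * (1 - b)))"
      by (simp add: algebra_simps)
    then have "s + t \<le> (C + 1) * (s * a + t * (1 - b))"
      using assms(1) by simp
    then have "(s + t) / (C + 1) \<le> s * a + t * (1 - b)"
      using assms(1) by (simp add: field_simps)
    then show ?thesis by linarith
  qed
qed

text \<open>The incoming message 0 has weight \<open>1 - x\<close> under the first hypothesis and
  \<open>y\<close> under the second; message 1 has weights \<open>x\<close> and
  \<open>1 - y\<close>. The test bound applies to each message separately, and it remains to add two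
  minima. Choosing \<open>y\<close> and \<open>x\<close> needs the lower bound on
  \<open>x + y\<close>. Choosing \<open>1 - x\<close> and \<open>1 - y\<close>, as an agent that
  inverts its input would, needs the upper one. In all other combinations the sum is at least
  \<open>d\<close> because all four weights lie in the unit interval.\<close>

lemma error_sum_step:
  fixes a a' b b' x y C :: real
  defines "d \<equiv> 1 / (C + 1)"
  assumes "1 < C" "0 \<le> x" "x \<le> 1" "0 \<le> y" "y \<le> 1" "d \<le> x + y" "x + y \<le> 2 - d"
    and "0 \<le> a" "a' \<le> 1" "a' \<le> C * a" "1 - a \<le> C * (1 - a')"
    and "0 \<le> b" "b' \<le> 1" "b' \<le> C * b" "1 - b \<le> C * (1 - b')"
  shows "d \<le> ((1 - x) * a + x * b) + (y * (1 - a') + (1 - y) * (1 - b'))"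
proof -
  have d: "0 < d" "d < 1 / 2" using assms(2) by (simp_all add: d_def pos_divide_less_eq)
  have div: "(u + v) / (C + 1) = d * u + d * v" for u v
    by (simp add: d_def add_divide_distrib)
  have "min (min (1 - x) y) (((1 - x) + y) / (C + 1)) \<le> (1 - x) * a + y * (1 - a')"
    using assms by (intro likelihood_ratio_test_bound) auto
  moreover have "min (min x (1 - y)) ((x + (1 - y)) / (C + 1)) \<le> x * b + (1 - y) * (1 - b')"
    using assms by (intro likelihood_ratio_test_bound) auto
  moreover have "0 \<le> d * x" "0 \<le> d * y" "d * x \<le> x" "d * y \<le> y"
    "d * (1 - x) \<le> 1 - x" "d * (1 - y) \<le> 1 - y" "0 \<le> d * (1 - x)" "0 \<le> d * (1 - y)"
    using assms(3-6) d by (simp_all add: mult_left_le_one_le)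
  ultimately show ?thesis
    using assms(3-8) d unfolding div right_diff_distrib mult_1_right by linarith
qed

text \<open>The bound does not depend on \<open>N\<close>: a one-bit message cannot accumulate
  evidence when every observation has a likelihood ratio between \<open>1 / C\<close> and
  \<open>C\<close>.\<close>

lemma tandem_error_sum_ge:
  fixes C :: real
  assumes rules: "decision_rules M N \<phi>"
    and Q: "Q0 \<in> space (prob_algebra M)" "Q1 \<in> space (prob_algebra M)"
    and C: "1 < C"
    and Q01: "\<And>A. A \<in> sets M \<Longrightarrow> measure Q0 A \<le> C * measure Q1 A"
    and Q10: "\<And>A. A \<in> sets M \<Longrightarrow> measure Q1 A \<le> C * measure Q0 A"
  shows "1 / (C + 1) \<le>
    measure (PiM {1..N} (\<lambda>_. Q0)) {y \<in> space (PiM {1..N} (\<lambda>_. Q0)). decision \<phi> N y} +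
    measure (PiM {1..N} (\<lambda>_. Q1)) {y \<in> space (PiM {1..N} (\<lambda>_. Q1)). \<not> decision \<phi> N y}"
proof -
  define x where "x R m = measure (PiM {1..m} (\<lambda>_. R)) {y \<in> space (PiM {1..m} (\<lambda>_. R)). decision \<phi> m y}"
    for R :: "'a measure" and m :: nat
  define a where "a R m u = measure R {y \<in> space M. \<phi> (Suc m) y u}"
    for R :: "'a measure" and m :: nat and u
  define d where "d = 1 / (C + 1)"
  have d: "0 < d" "d < 1" using C by (auto simp: d_def)
  have prob: "prob_space Q0" "prob_space Q1" and sQ: "sets Q0 = sets M" "sets Q1 = sets M"
    using Q by (auto simp: space_prob_algebra)
  have spQ: "space Q0 = space M" "space Q1 = space M" using sQ by (auto dest: sets_eq_imp_space_eq)
  have P: "prob_space (PiM {1..m} (\<lambda>_. Q0))" "prob_space (PiM {1..m} (\<lambda>_. Q1))" for m :: nat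
    using prob by (auto intro: prob_space_PiM)
  have x01: "0 \<le> x Q0 m" "x Q0 m \<le> 1" "0 \<le> x Q1 m" "x Q1 m \<le> 1" for m
    unfolding x_def using P[THEN prob_space.prob_le_1] by auto
  have a01: "0 \<le> a Q0 m u" "a Q0 m u \<le> 1" "0 \<le> a Q1 m u" "a Q1 m u \<le> 1" for m u
    unfolding a_def using prob[THEN prob_space.prob_le_1] by auto
  \<comment> \<open>The last two inequalities are the first two for the complemented rule, with
    \<open>1 - a\<close> in place of \<open>a\<close>.\<close>
  have aC: "a Q1 m u \<le> C * a Q0 m u" "1 - a Q0 m u \<le> C * (1 - a Q1 m u)"
    "a Q0 m u \<le> C * a Q1 m u" "1 - a Q1 m u \<le> C * (1 - a Q0 m u)" if "m < N" for m u
  proof -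
    let ?A = "{y \<in> space M. \<phi> (Suc m) y u}"
    have A: "?A \<in> sets M" using that by (intro measurable_decision_rule[OF rules]) auto
    have compl: "measure Q0 (space M - ?A) = 1 - a Q0 m u" "measure Q1 (space M - ?A) = 1 - a Q1 m u"
      using A sQ prob[THEN prob_space.prob_compl, of ?A] by (simp_all add: a_def spQ)
    have "space M - ?A \<in> sets M" using A by auto
    from Q01[OF this] Q10[OF this] Q01[OF A] Q10[OF A] compl
    show "a Q1 m u \<le> C * a Q0 m u" "1 - a Q0 m u \<le> C * (1 - a Q1 m u)"
    "a Q0 m u \<le> C * a Q1 m u" "1 - a Q1 m u \<le> C * (1 - a Q0 m u)"
      by (simp_all add: a_def)
  qed
  have inv: "d \<le> x Q0 n + (1 - x Q1 n) \<and> x Q0 n + (1 - x Q1 n) \<le> 2 - d" if "n \<le> N" for n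
    using that
  proof (induction n)
    \<comment> \<open>The initial message \<open>False\<close> gives the error probabilities 0 and
      1, with sum 1.\<close>
    case 0
    then show ?case using d by (simp add: x_def)
  next
    case (Suc n)
    have xs: "x Q0 (Suc n) = (1 - x Q0 n) * a Q0 n False + x Q0 n * a Q0 n True"
       "x Q1 (Suc n) = (1 - x Q1 n) * a Q1 n False + x Q1 n * a Q1 n True"
      unfolding x_def a_def using Suc.prems by (intro prob_decision_Suc[OF rules] Q; simp)+
    have "d \<le> ((1 - x Q0 n) * a Q0 n False + x Q0 n * a Q0 n True) +
       ((1 - x Q1 n) * (1 - a Q1 n False) + (1 - (1 - x Q1 n)) * (1 - a Q1 n True))"
      unfolding d_def
      using Suc x01[of n] a01[of n] aC[of n] C
      by (intro error_sum_step) (simp_all add: d_def)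
    \<comment> \<open>the rule with complemented output exchanges the two bounds\<close>
    moreover have "d \<le> ((1 - x Q0 n) * (1 - a Q0 n False) + x Q0 n * (1 - a Q0 n True)) +
       ((1 - x Q1 n) * (1 - (1 - a Q1 n False)) + (1 - (1 - x Q1 n)) * (1 - (1 - a Q1 n True)))"
      unfolding d_def
      using Suc x01[of n] a01[of n] aC[of n] C
      by (intro error_sum_step) (simp_all add: d_def)
    ultimately show ?case unfolding xs by (simp add: algebra_simps)
  qed
  have "decision \<phi> N \<in> PiM {1..N} (\<lambda>_. Q1) \<rightarrow>\<^sub>M count_space UNIV"
    using sQ by (intro measurable_decision[OF rules]) auto
  then have "{y \<in> space (PiM {1..N} (\<lambda>_. Q1)). decision \<phi> N y} \<in> sets (PiM {1..N} (\<lambda>_. Q1))"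
    by simp
  from prob_space.prob_compl[OF P(2) this]
  have "measure (PiM {1..N} (\<lambda>_. Q1)) {y \<in> space (PiM {1..N} (\<lambda>_. Q1)). \<not> decision \<phi> N y}
      = 1 - x Q1 N"
    by (simp add: x_def set_diff_eq cong: conj_cong)
  then show ?thesis using inv[of N] by (simp add: x_def d_def)
qed

section \<open>The worst-case error as a supremum over the uncertainty classes\<close>

lemma contamination_class_self:
  assumes "P \<in> space (prob_algebra M)"
  shows "P \<in> contamination_class M e P"
  unfolding contamination_class_def using assms by (auto simp: algebra_simps intro!: bexI[of _ P])

lemma uncertainty_product_prob:
  assumes "Q \<in> uncertainty_product M eps P N" "k \<in> {1..N}"
  shows "prob_space (Q k)" "sets (Q k) = sets M" "Q k \<in> contamination_class M (eps k) P"
  using assms by (auto simp: uncertainty_product_def contamination_class_def space_prob_algebra PiE_iff)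

lemma error_prob_le_worst_error:
  assumes "0 \<le> \<pi>0" "0 \<le> \<pi>1"
    and "Q0 \<in> uncertainty_product M eps0 P0 N" "Q1 \<in> uncertainty_product M eps1 P1 N"
  shows "error_prob \<pi>0 \<pi>1 N \<phi> Q0 Q1 \<le> worst_error M \<pi>0 \<pi>1 eps0 eps1 P0 P1 N \<phi>"
proof -
  have "error_prob \<pi>0 \<pi>1 N \<phi> R0 R1 \<le> \<pi>0 * 1 + \<pi>1 * 1"
    if "R0 \<in> uncertainty_product M eps0 P0 N" "R1 \<in> uncertainty_product M eps1 P1 N" for R0 R1
    unfolding error_prob_def using that assms(1,2)
    by (intro add_mono mult_left_mono prob_space.prob_le_1 prob_space_PiM)
      (auto intro: uncertainty_product_prob)
  \<comment> \<open>A supremum of reals dominates the members only if the family is bounded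
    above.\<close>
  then have "bdd_above ((\<lambda>(Q0, Q1). error_prob \<pi>0 \<pi>1 N \<phi> Q0 Q1) `
     (uncertainty_product M eps0 P0 N \<times> uncertainty_product M eps1 P1 N))"
    by (intro bdd_aboveI[of _ "\<pi>0 * 1 + \<pi>1 * 1"]) auto
  moreover have "(Q0, Q1) \<in> uncertainty_product M eps0 P0 N \<times> uncertainty_product M eps1 P1 N"
    using assms by simp
  ultimately show ?thesis unfolding worst_error_def by (rule cSUP_upper2) simp
qed

lemma worst_error_le:
  assumes "P0 \<in> space (prob_algebra M)" "P1 \<in> space (prob_algebra M)"
    and "\<And>Q0 Q1. Q0 \<in> uncertainty_product M eps0 P0 N \<Longrightarrow> Q1 \<in> uncertainty_product M eps1 P1 N
      \<Longrightarrow> error_prob \<pi>0 \<pi>1 N \<phi> Q0 Q1 \<le> b"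
  shows "worst_error M \<pi>0 \<pi>1 eps0 eps1 P0 P1 N \<phi> \<le> b"
proof -
  have "uncertainty_product M eps P N \<noteq> {}" if "P \<in> space (prob_algebra M)" for eps P
    using contamination_class_self[OF that] by (auto simp: uncertainty_product_def PiE_eq_empty_iff)
  then show ?thesis
    unfolding worst_error_def using assms by (intro cSUP_least) auto
qed

lemma worst_error_nonneg:
  assumes "0 \<le> \<pi>0" "0 \<le> \<pi>1" "P0 \<in> space (prob_algebra M)" "P1 \<in> space (prob_algebra M)"
  shows "0 \<le> worst_error M \<pi>0 \<pi>1 eps0 eps1 P0 P1 N \<phi>"
proof -
  have "restrict (\<lambda>_. P) {1..N} \<in> uncertainty_product M eps P N"
    if "P \<in> space (prob_algebra M)" for eps P
    using contamination_class_self[OF that] by (auto simp: uncertainty_product_def)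
  from error_prob_le_worst_error[OF assms(1,2) this[OF assms(3)] this[OF assms(4)]]
  have "error_prob \<pi>0 \<pi>1 N \<phi> (restrict (\<lambda>_. P0) {1..N}) (restrict (\<lambda>_. P1) {1..N})
      \<le> worst_error M \<pi>0 \<pi>1 eps0 eps1 P0 P1 N \<phi>" .
  moreover have "0 \<le> error_prob \<pi>0 \<pi>1 N \<phi> Q0 Q1" for Q0 Q1
    using assms(1,2) by (simp add: error_prob_def)
  ultimately show ?thesis by (rule order_trans[rotated])
qed

lemma worst_error_ge:
  fixes C :: real
  assumes rules: "decision_rules M N \<phi>"
    and pi: "0 \<le> \<pi>0" "0 \<le> \<pi>1"
    and Q: "\<And>k. k \<in> {1..N} \<Longrightarrow> Q0 \<in> contamination_class M (eps0 k) P0"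
      "\<And>k. k \<in> {1..N} \<Longrightarrow> Q1 \<in> contamination_class M (eps1 k) P1"
    and prob: "Q0 \<in> space (prob_algebra M)" "Q1 \<in> space (prob_algebra M)"
    and C: "1 < C"
    and Q01: "\<And>A. A \<in> sets M \<Longrightarrow> measure Q0 A \<le> C * measure Q1 A"
    and Q10: "\<And>A. A \<in> sets M \<Longrightarrow> measure Q1 A \<le> C * measure Q0 A"
  shows "min \<pi>0 \<pi>1 / (C + 1) \<le> worst_error M \<pi>0 \<pi>1 eps0 eps1 P0 P1 N \<phi>"
proof -
  \<comment> \<open>The product of classes consists of extensional functions, hence
    \<open>restrict\<close>; \<open>PiM\<close> reads them on the index set only.\<close>
  let ?R0 = "restrict (\<lambda>_. Q0) {1..N}" and ?R1 = "restrict (\<lambda>_. Q1) {1..N}"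
  let ?x = "measure (PiM {1..N} (\<lambda>_. Q0)) {y \<in> space (PiM {1..N} (\<lambda>_. Q0)). decision \<phi> N y}"
  let ?y = "measure (PiM {1..N} (\<lambda>_. Q1)) {y \<in> space (PiM {1..N} (\<lambda>_. Q1)). \<not> decision \<phi> N y}"
  have "1 / (C + 1) \<le> ?x + ?y"
    by (rule tandem_error_sum_ge[OF rules prob C]) (fact Q01, fact Q10)
  then have "min \<pi>0 \<pi>1 * (1 / (C + 1)) \<le> min \<pi>0 \<pi>1 * (?x + ?y)"
    by (rule mult_left_mono) (use pi in simp)
  also have "\<dots> \<le> \<pi>0 * ?x + \<pi>1 * ?y"
    unfolding distrib_left by (intro add_mono mult_right_mono) auto
  also have "\<dots> = error_prob \<pi>0 \<pi>1 N \<phi> ?R0 ?R1"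
  proof -
    have "PiM {1..N} ?R0 = PiM {1..N} (\<lambda>_. Q0)" "PiM {1..N} ?R1 = PiM {1..N} (\<lambda>_. Q1)"
      by (auto intro: PiM_cong)
    then show ?thesis by (simp add: error_prob_def)
  qed
  also have "\<dots> \<le> worst_error M \<pi>0 \<pi>1 eps0 eps1 P0 P1 N \<phi>"
    using Q pi by (intro error_prob_le_worst_error) (auto simp: uncertainty_product_def)
  finally show ?thesis by simp
qed

section \<open>Mixtures and essential bounds on likelihood ratios\<close>

lemma mixture_in_contamination_class:
  fixes p r :: "'a \<Rightarrow> real"
  assumes "P \<in> space (prob_algebra M)" "R \<in> space (prob_algebra M)" "0 \<le> e" "e \<le> 1"
    and "sets \<mu> = sets M"
    and [measurable]: "p \<in> borel_measurable M" "r \<in> borel_measurable M"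
    and "P = density \<mu> (\<lambda>y. ennreal (p y))" "R = density \<mu> (\<lambda>y. ennreal (r y))"
  obtains Q where "Q \<in> contamination_class M e P" "Q \<in> space (prob_algebra M)"
    "\<And>A. A \<in> sets M \<Longrightarrow> measure Q A = (1 - e) * measure P A + e * measure R A"
proof -
  \<comment> \<open>Taking the convex combination at the level of densities makes the mixture a
    measure without further proof.\<close>
  define Q where "Q = density \<mu> (\<lambda>y. ennreal (1 - e) * ennreal (p y) + ennreal e * ennreal (r y))"
  have [measurable]: "p \<in> borel_measurable \<mu>" "r \<in> borel_measurable \<mu>"
    using assms(5-7) by (auto cong: measurable_cong_sets)
  interpret P: prob_space P using assms(1) by (simp add: space_prob_algebra)
  interpret R: prob_space R using assms(2) by (simp add: space_prob_algebra)
  have em: "emeasure Q A = ennreal ((1 - e) * measure P A + e * measure R A)" if "A \<in> sets M" for A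
  proof -
    have A[measurable]: "A \<in> sets \<mu>" using that assms by simp
    have "emeasure Q A = (\<integral>\<^sup>+y. ennreal (1 - e) * (ennreal (p y) * indicator A y)
         + ennreal e * (ennreal (r y) * indicator A y) \<partial>\<mu>)"
      by (simp add: Q_def emeasure_density distrib_right mult.assoc)
    also have "\<dots> = ennreal (1 - e) * emeasure P A + ennreal e * emeasure R A"
      using A by (simp add: nn_integral_add nn_integral_cmult assms(8,9) emeasure_density)
    finally show ?thesis
      using assms(3,4)
      by (simp add: P.emeasure_eq_measure R.emeasure_eq_measure ennreal_mult ennreal_plus)
  qed
  have sQ: "sets Q = sets M" by (simp add: Q_def assms)
  have sp: "space P = space M" "space R = space M"
    using assms(1,2) by (auto simp: space_prob_algebra dest: sets_eq_imp_space_eq)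
  have "prob_space Q"
  proof
    show "emeasure Q (space Q) = 1"
      using em[of "space M"] sets_eq_imp_space_eq[OF sQ] P.prob_space R.prob_space
      by (simp add: sp)
  qed
  then have Q: "Q \<in> space (prob_algebra M)" using sQ by (simp add: space_prob_algebra)
  have meas: "measure Q A = (1 - e) * measure P A + e * measure R A" if "A \<in> sets M" for A
    using em[OF that] assms(3,4) by (simp add: measure_def[of Q] del: ennreal_plus)
  show ?thesis
    by (rule that[OF _ Q meas]) (use Q meas assms(2) in \<open>auto simp: contamination_class_def\<close>)
qed

text \<open>Where a density vanishes, both quotients are 0 and \<open>ln 0 = 0\<close>, so the
  identity holds at every point.\<close>

lemma log_likelihood_ratio_flip:
  "log_likelihood_ratio q p y = - log_likelihood_ratio p q y"
  unfolding log_likelihood_ratio_def using ln_inverse[of "p y / q y"] by (simp add: inverse_eq_divide)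

lemma ess_unbounded_above_uminus:
  "ess_unbounded_above P (\<lambda>y. - f y) \<longleftrightarrow> ess_unbounded_below P f"
proof -
  have "(AE y in P. - f y \<le> c) \<longleftrightarrow> (AE y in P. - c \<le> f y)" for c
    by (simp add: minus_le_iff)
  then show ?thesis
    unfolding ess_unbounded_above_def ess_unbounded_below_def by (metis minus_minus)
qed

lemma ess_bounded_likelihood_ratio:
  fixes p q :: "'a \<Rightarrow> real"
  assumes prob: "P \<in> space (prob_algebra M)" "Q \<in> space (prob_algebra M)"
    and ac: "absolutely_continuous P Q"
    and \<mu>: "sets \<mu> = sets M"
    and p: "p \<in> borel_measurable M" "P = density \<mu> (\<lambda>y. ennreal (p y))"
    and q: "q \<in> borel_measurable M" "Q = density \<mu> (\<lambda>y. ennreal (q y))"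
    and bounded: "\<not> ess_unbounded_above P (log_likelihood_ratio q p)"
  obtains c where "\<And>A. A \<in> sets M \<Longrightarrow> measure Q A \<le> c * measure P A"
proof -
  have [measurable]: "p \<in> borel_measurable \<mu>" "q \<in> borel_measurable \<mu>"
    using \<mu> p(1) q(1) by (auto cong: measurable_cong_sets)
  have sPQ: "sets Q = sets P" using prob by (simp add: space_prob_algebra)
  obtain c where "AE y in P. log_likelihood_ratio q p y \<le> c"
    using bounded by (auto simp: ess_unbounded_above_def)
  \<comment> \<open>Where \<open>p\<close> vanishes the logarithm takes its default value 0 and
    bounds nothing. Such points are null for \<open>P\<close>, and by absolute continuity also for
    \<open>Q\<close>.\<close>
  then have "AE y in P. log_likelihood_ratio q p y \<le> c \<and> 0 < p y"
    unfolding p(2) by (simp add: AE_density)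
  then have "AE y in Q. log_likelihood_ratio q p y \<le> c \<and> 0 < p y"
    by (rule absolutely_continuous_AE[OF sPQ ac])
  \<comment> \<open>Where \<open>q\<close> is not positive, the desired inequality of densities is
    trivial.\<close>
  then have "AE y in \<mu>. 0 < q y \<longrightarrow> log_likelihood_ratio q p y \<le> c \<and> 0 < p y"
    unfolding q(2) by (simp add: AE_density del: AE_conj_iff)
  then have le: "AE y in \<mu>. ennreal (q y) \<le> ennreal (exp c) * ennreal (p y)"
  proof (rule AE_mp, intro AE_I2 impI)
    fix y assume y: "y \<in> space \<mu>"
      and *: "0 < q y \<longrightarrow> log_likelihood_ratio q p y \<le> c \<and> 0 < p y"
    show "ennreal (q y) \<le> ennreal (exp c) * ennreal (p y)"
    proof (cases "0 < q y")
      case True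
      with * have "ln (q y / p y) \<le> c" "0 < p y" by (auto simp: log_likelihood_ratio_def)
      then have "q y / p y \<le> exp c" using True by (metis divide_pos_pos exp_le_cancel_iff exp_ln)
      then have "q y \<le> exp c * p y" using \<open>0 < p y\<close> by (simp add: field_simps)
      then show ?thesis by (simp add: ennreal_mult[symmetric] ennreal_leI \<open>0 < p y\<close> less_imp_le)
    qed (simp add: ennreal_neg)
  qed
  interpret P: prob_space P using prob by (simp add: space_prob_algebra)
  interpret Q: prob_space Q using prob by (simp add: space_prob_algebra)
  have "measure Q A \<le> exp c * measure P A" if "A \<in> sets M" for A
  proof -
    have A[measurable]: "A \<in> sets \<mu>" using that \<mu> by simp
    have "emeasure Q A = (\<integral>\<^sup>+y. ennreal (q y) * indicator A y \<partial>\<mu>)"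
      by (simp add: q(2) emeasure_density)
    also have "\<dots> \<le> (\<integral>\<^sup>+y. ennreal (exp c) * (ennreal (p y) * indicator A y) \<partial>\<mu>)"
      using le by (intro nn_integral_mono_AE) (auto simp: indicator_def)
    also have "\<dots> = ennreal (exp c) * emeasure P A"
      by (simp add: p(2) emeasure_density nn_integral_cmult)
    finally show ?thesis
      by (simp add: P.emeasure_eq_measure Q.emeasure_eq_measure ennreal_mult[symmetric])
  qed
  then show ?thesis by (rule that)
qed

text \<open>The event is the set where the log-likelihood ratio exceeds \<open>ln c\<close>. It has
  positive probability because \<open>ln c\<close> is not an essential upper bound, and
  \<open>c * p \<le> q\<close> holds pointwise on it. Positivity is what later permits dividing by
  \<open>measure P A\<close>.\<close>

lemma ess_unbounded_likelihood_ratio: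
  fixes p q :: "'a \<Rightarrow> real"
  assumes prob: "P \<in> space (prob_algebra M)" "Q \<in> space (prob_algebra M)"
    and \<mu>: "sets \<mu> = sets M"
    and p: "p \<in> borel_measurable M" "\<And>y. y \<in> space M \<Longrightarrow> 0 \<le> p y" "P = density \<mu> (\<lambda>y. ennreal (p y))"
    and q: "q \<in> borel_measurable M" "\<And>y. y \<in> space M \<Longrightarrow> 0 \<le> q y" "Q = density \<mu> (\<lambda>y. ennreal (q y))"
    and unbounded: "ess_unbounded_above P (log_likelihood_ratio q p)"
    and c: "1 \<le> c"
  obtains A where "A \<in> sets M" "0 < measure P A" "c * measure P A \<le> measure Q A"
proof -
  note [measurable] = p(1) q(1)
  have [measurable]: "p \<in> borel_measurable \<mu>" "q \<in> borel_measurable \<mu>"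
    using \<mu> p(1) q(1) by (auto cong: measurable_cong_sets)
  interpret P: prob_space P using prob by (simp add: space_prob_algebra)
  interpret Q: prob_space Q using prob by (simp add: space_prob_algebra)
  have sP: "sets P = sets M" "space P = space M"
    using prob by (auto simp: space_prob_algebra dest: sets_eq_imp_space_eq)
  define A where "A = {y \<in> space M. ln c < log_likelihood_ratio q p y}"
  have A: "A \<in> sets M" unfolding A_def log_likelihood_ratio_def by measurable
  have "\<not> (AE y in P. log_likelihood_ratio q p y \<le> ln c)"
    using unbounded by (auto simp: ess_unbounded_above_def)
  then have "\<not> (AE y in P. y \<notin> A)"
    by (rule contrapos_nn) (erule AE_mp, rule AE_I2, simp add: A_def sP(2) not_less)
  then have pos: "0 < measure P A"
    using A sP P.prob_eq_0[of A] by (simp add: zero_less_measure_iff P.emeasure_eq_measure)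
  have le: "ennreal c * ennreal (p y) \<le> ennreal (q y)" if "y \<in> A" for y
  proof -
    have y: "y \<in> space M" "ln c < ln (q y / p y)" using that by (auto simp: A_def log_likelihood_ratio_def)
    \<comment> \<open>both densities are positive, since the junk value \<open>ln 0 = 0\<close> does not exceed \<open>ln c\<close>\<close>
    have "0 \<le> ln c" using c by simp
    then have "q y / p y \<noteq> 0" using y(2) by force
    then have pq: "0 < p y" "0 < q y" using p(2)[OF y(1)] q(2)[OF y(1)] by auto
    then have "c < q y / p y" using y(2) c by (subst (asm) ln_less_cancel_iff) auto
    then have "c * p y \<le> q y" using pq by (simp add: field_simps)
    then show ?thesis using c pq by (simp add: ennreal_mult[symmetric] ennreal_leI)
  qed
  have A\<mu>[measurable]: "A \<in> sets \<mu>" using A \<mu> by simp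
  have "ennreal c * emeasure P A = (\<integral>\<^sup>+y. ennreal c * (ennreal (p y) * indicator A y) \<partial>\<mu>)"
    by (simp add: p(3) emeasure_density nn_integral_cmult)
  also have "\<dots> \<le> (\<integral>\<^sup>+y. ennreal (q y) * indicator A y \<partial>\<mu>)"
    using le by (intro nn_integral_mono) (auto simp: indicator_def)
  also have "\<dots> = emeasure Q A" by (simp add: q(3) emeasure_density)
  finally have "c * measure P A \<le> measure Q A"
    using c by (simp add: P.emeasure_eq_measure Q.emeasure_eq_measure ennreal_mult[symmetric])
  with A pos show ?thesis by (rule that)
qed

section \<open>Rare events and the alarm strategy\<close>

text \<open>\<open>n\<close> is the largest number of agents for which the union bound keeps the
  false alarm probability at most \<delta>. The factor \<open>c\<close> then makes the expected
  number of genuine alarms so large that missing all of them is just as unlikely.\<close>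

lemma exists_rare_event:
  fixes p q :: "'a \<Rightarrow> real" and e \<delta> :: real
  assumes prob: "P \<in> space (prob_algebra M)" "Q \<in> space (prob_algebra M)"
    and \<mu>: "sets \<mu> = sets M"
    and p: "p \<in> borel_measurable M" "\<And>y. y \<in> space M \<Longrightarrow> 0 \<le> p y" "P = density \<mu> (\<lambda>y. ennreal (p y))"
    and q: "q \<in> borel_measurable M" "\<And>y. y \<in> space M \<Longrightarrow> 0 \<le> q y" "Q = density \<mu> (\<lambda>y. ennreal (q y))"
    and unbounded: "ess_unbounded_above P (log_likelihood_ratio q p)"
    and e: "e < 1" and \<delta>: "0 < \<delta>"
  obtains A n where "A \<in> sets M" "real n * measure P A \<le> \<delta>"
    "exp (- (real n * ((1 - e) * measure Q A))) \<le> \<delta>"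
proof -
  interpret Q: prob_space Q using prob by (simp add: space_prob_algebra)
  \<comment> \<open>\<open>c\<close> is chosen to give
    \<open>\<delta> * c - 1 \<ge> - ln \<delta> / (1 - e)\<close>. The summand 1 pays for rounding
    down \<open>n\<close>, which loses at most \<open>measure Q A \<le> 1\<close>.\<close>
  define c where "c = max 1 ((1 + (- ln \<delta>) / (1 - e)) / \<delta>)"
  have c: "1 \<le> c" "(1 + (- ln \<delta>) / (1 - e)) / \<delta> \<le> c" by (auto simp: c_def)
  obtain A where A: "A \<in> sets M" "0 < measure P A" "c * measure P A \<le> measure Q A"
    by (rule ess_unbounded_likelihood_ratio[OF prob \<mu> p q unbounded c(1)])
  define n where "n = nat \<lfloor>\<delta> / measure P A\<rfloor>"
  have "0 \<le> \<delta> / measure P A" using \<delta> A by simp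
  then have n: "real n \<le> \<delta> / measure P A" "\<delta> / measure P A - 1 \<le> real n"
    unfolding n_def by linarith+
  have "real n * measure P A \<le> \<delta>" using n(1) A(2) by (simp add: field_simps)
  moreover have "- ln \<delta> \<le> real n * ((1 - e) * measure Q A)"
  proof -
    have "(- ln \<delta>) / (1 - e) \<le> \<delta> * c - 1"
      using c(2) \<delta> by (simp add: pos_divide_le_eq mult.commute)
    also have "\<delta> * c \<le> \<delta> / measure P A * measure Q A"
      using mult_left_mono[OF A(3), of "\<delta> / measure P A"] \<delta> A(2) by (simp add: mult.commute)
    also have "\<dots> - 1 \<le> (\<delta> / measure P A - 1) * measure Q A"
      using Q.prob_le_1[of A] by (simp add: algebra_simps)
    also have "\<dots> \<le> real n * measure Q A" using n(2) by (intro mult_right_mono) auto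
    finally show ?thesis using e by (simp add: field_simps)
  qed
  then have "exp (- (real n * ((1 - e) * measure Q A))) \<le> exp (ln \<delta>)" by simp
  ultimately show ?thesis using that A(1) \<delta> by simp
qed

text \<open>An alarm, once raised by one of the first \<open>n\<close> agents, is passed on. The flag \<open>b\<close> complements
  the encoding, so that the messages are \<open>b\<close> until an alarm occurs; agent 1 ignores the fixed
  input \<open>False\<close>.\<close>
definition alarm_rule :: "'y set \<Rightarrow> nat \<Rightarrow> bool \<Rightarrow> nat \<Rightarrow> 'y \<Rightarrow> bool \<Rightarrow> bool" where
  "alarm_rule A n b k y u \<longleftrightarrow> ((k \<noteq> 1 \<and> u \<noteq> b) \<or> (k \<le> n \<and> y \<in> A)) \<noteq> b"

text \<open>The induction starts at agent 1: for \<open>k = 0\<close> and \<open>b = True\<close>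
  the message is \<open>False\<close> although no alarm has occurred.\<close>

lemma decision_alarm_rule:
  "1 \<le> k \<Longrightarrow> decision (alarm_rule A n b) k y \<longleftrightarrow> (\<exists>j\<in>{1..k}. j \<le> n \<and> y j \<in> A) \<noteq> b"
proof (induction k)
  case (Suc k)
  then show ?case
    by (cases "k = 0") (auto simp: alarm_rule_def atLeastAtMostSuc_conv)
qed simp

lemma decision_rules_alarm_rule:
  assumes [measurable]: "A \<in> sets M"
  shows "decision_rules M N (alarm_rule A n b)"
  unfolding decision_rules_def alarm_rule_def by measurable

lemma prob_no_alarm:
  fixes N n :: nat
  assumes Q: "\<And>k. k \<in> {1..N} \<Longrightarrow> prob_space (Q k)" "\<And>k. k \<in> {1..N} \<Longrightarrow> sets (Q k) = sets M"
    and A: "A \<in> sets M" and n: "n \<le> N"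
  defines "E \<equiv> {y \<in> space (PiM {1..N} Q). \<not> (\<exists>j\<in>{1..N}. j \<le> n \<and> y j \<in> A)}"
  shows "measure (PiM {1..N} Q) E = (\<Prod>k\<in>{1..n}. 1 - measure (Q k) A)"
    and "measure (PiM {1..N} Q) (space (PiM {1..N} Q) - E) = 1 - (\<Prod>k\<in>{1..n}. 1 - measure (Q k) A)"
proof -
  \<comment> \<open>The product space locale wants a probability measure at every index, so the
    family is extended by a point mass outside \<open>{1..N}\<close>.\<close>
  define R where "R k = (if k \<in> {1..N} then Q k else return (count_space UNIV) undefined)" for k
  have R: "prob_space (R k)" for k
    using Q by (auto simp: R_def intro!: prob_space_return)
  interpret R: prob_space "R k" for k by (rule R)
  interpret product_prob_space R by unfold_locales
  have PQ: "PiM {1..N} Q = PiM {1..N} R" by (rule PiM_cong) (auto simp: R_def)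
  interpret PP: prob_space "PiM {1..N} R" by (rule prob_space_PiM) (rule R)
  have sR: "sets (R k) = sets M" "space (R k) = space M" if "k \<in> {1..N}" for k
    using Q(2)[OF that] that by (auto simp: R_def dest: sets_eq_imp_space_eq)
  let ?B = "\<lambda>k. if k \<le> n then space M - A else space M"
  \<comment> \<open>The event is a box, so its probability factorizes; agents after \<open>n\<close>
    contribute the factor 1.\<close>
  have E: "E = Pi\<^sub>E {1..N} ?B"
  proof -
    have "space (PiM {1..N} R) = Pi\<^sub>E {1..N} (\<lambda>_. space M)"
      unfolding space_PiM using sR(2) by (intro PiE_cong) auto
    moreover have "z \<in> ?B k \<longleftrightarrow> z \<in> space M \<and> \<not> (k \<le> n \<and> z \<in> A)" for z k by simp
    ultimately show ?thesis by (simp only: E_def PQ PiE_iff set_eq_iff mem_Collect_eq) blast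
  qed
  have B: "?B k \<in> sets (R k)" if "k \<in> {1..N}" for k using that A sR by auto
  have "emeasure (PiM {1..N} R) E = (\<Prod>k\<in>{1..N}. emeasure (R k) (?B k))"
    unfolding E using B by (intro emeasure_PiM) auto
  also have "\<dots> = ennreal (\<Prod>k\<in>{1..N}. measure (R k) (?B k))"
    by (simp add: R.emeasure_eq_measure prod_ennreal)
  finally have "measure (PiM {1..N} R) E = (\<Prod>k\<in>{1..N}. measure (R k) (?B k))"
    by (simp add: PP.emeasure_eq_measure prod_nonneg del: One_nat_def)
  also have "\<dots> = (\<Prod>k\<in>{1..n}. 1 - measure (Q k) A)"
  proof (rule prod.mono_neutral_cong_right)
    show "\<forall>k\<in>{1..N} - {1..n}. measure (R k) (?B k) = 1"
    proof
      fix k assume k: "k \<in> {1..N} - {1..n}"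
      then show "measure (R k) (?B k) = 1" using sR(2)[of k] R.prob_space[of k] by auto
    qed
    show "measure (R k) (?B k) = 1 - measure (Q k) A" if "k \<in> {1..n}" for k
    proof -
      have k: "k \<in> {1..N}" "R k = Q k" using that n by (auto simp: R_def)
      then show ?thesis using that sR[of k] A R.prob_compl[of A k] by auto
    qed
  qed (use n in auto)
  finally show *: "measure (PiM {1..N} Q) E = (\<Prod>k\<in>{1..n}. 1 - measure (Q k) A)"
    by (simp only: PQ)
  have "E \<in> sets (PiM {1..N} R)" unfolding E using B by (intro sets_PiM_I_finite) auto
  then show "measure (PiM {1..N} Q) (space (PiM {1..N} Q) - E) = 1 - (\<Prod>k\<in>{1..n}. 1 - measure (Q k) A)"
    using PP.prob_compl * by (simp add: PQ del: One_nat_def)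
qed

lemma prob_alarm_uncontaminated:
  assumes Q: "Q \<in> uncertainty_product M eps P N" and eps: "\<And>k. k \<in> {1..N} \<Longrightarrow> eps k = 0"
    and P: "prob_space P" and A: "A \<in> sets M" and n: "n \<le> N"
  shows "measure (PiM {1..N} Q) {y \<in> space (PiM {1..N} Q). \<exists>j\<in>{1..N}. j \<le> n \<and> y j \<in> A}
     \<le> real n * measure P A"
proof -
  interpret P: prob_space P by fact
  note pr = uncertainty_product_prob[OF Q]
  have eq: "{y \<in> space (PiM {1..N} Q). \<exists>j\<in>{1..N}. j \<le> n \<and> y j \<in> A} = space (PiM {1..N} Q) -
      {y \<in> space (PiM {1..N} Q). \<not> (\<exists>j\<in>{1..N}. j \<le> n \<and> y j \<in> A)}" by auto
  \<comment> \<open>Without contamination the class leaves no freedom on measurable sets.\<close>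
  have QA: "measure (Q k) A = measure P A" if "k \<in> {1..n}" for k
    using pr(3)[of k] that n eps[of k] A by (auto simp: contamination_class_def)
  have "(\<Prod>k\<in>{1..n}. 1 - measure (Q k) A) = (\<Prod>k\<in>{1..n}. 1 - measure P A)"
    using QA by (intro prod.cong) auto
  also have "\<dots> = (1 - measure P A) ^ n" by simp
  \<comment> \<open>The union bound, in the form of Bernoulli's inequality.\<close>
  also have "\<dots> \<ge> 1 - real n * measure P A"
    using Bernoulli_inequality[of "- measure P A" n] P.prob_le_1[of A] by simp
  finally show ?thesis unfolding eq using prob_no_alarm(2)[OF pr(1,2) A n] by simp
qed

text \<open>Contamination can remove at most the fraction \<open>e\<close> of the nominal
  probability of an alarm, so each agent stays silent with probability at most
  \<open>1 - t \<le> exp (- t)\<close> for \<open>t = (1 - e) * measure P A\<close>.\<close>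

lemma prob_no_alarm_contaminated:
  assumes Q: "Q \<in> uncertainty_product M eps P N" and eps: "\<And>k. k \<in> {1..N} \<Longrightarrow> eps k = e"
    and e: "0 \<le> e" and A: "A \<in> sets M" and n: "n \<le> N"
  shows "measure (PiM {1..N} Q) {y \<in> space (PiM {1..N} Q). \<not> (\<exists>j\<in>{1..N}. j \<le> n \<and> y j \<in> A)}
     \<le> exp (- (real n * ((1 - e) * measure P A)))"
proof -
  note pr = uncertainty_product_prob[OF Q]
  have "(\<Prod>k\<in>{1..n}. 1 - measure (Q k) A) \<le> (\<Prod>k\<in>{1..n}. exp (- ((1 - e) * measure P A)))"
  proof (rule prod_mono)
    fix k assume k: "k \<in> {1..n}"
    with n have k': "k \<in> {1..N}" by auto
    have "(1 - e) * measure P A \<le> measure (Q k) A"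
      using pr(3)[OF k'] eps[OF k'] A e by (auto simp: contamination_class_def)
    moreover have "1 - (1 - e) * measure P A \<le> exp (- ((1 - e) * measure P A))"
      using exp_ge_add_one_self[of "- ((1 - e) * measure P A)"] by simp
    ultimately show "0 \<le> 1 - measure (Q k) A \<and> 1 - measure (Q k) A \<le> exp (- ((1 - e) * measure P A))"
      using prob_space.prob_le_1[OF pr(1)[OF k'], of A] by simp
  qed
  also have "\<dots> = exp (- (real n * ((1 - e) * measure P A)))"
    by (simp flip: exp_of_nat_mult)
  finally show ?thesis using prob_no_alarm(1)[OF pr(1,2) A n] by simp
qed

section \<open>Comparing the two mixtures, and the equivalence\<close>

text \<open>For \<open>e > 0\<close> the right-hand mixture gives positive weight to both
  \<open>f\<close> and \<open>g\<close>, so it dominates any other mixture of them. Only for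
  \<open>e = 0\<close> does the bound of \<open>g\<close> by \<open>f\<close> have to come from the
  likelihood ratio.\<close>

lemma mixture_ratio_bounded:
  fixes f g :: "'a \<Rightarrow> real" and e e' :: real
  assumes e: "0 \<le> e" "e < 1" "0 \<le> e'" "e' < 1"
    and nonneg: "\<And>A. A \<in> S \<Longrightarrow> 0 \<le> f A" "\<And>A. A \<in> S \<Longrightarrow> 0 \<le> g A"
    and bounded: "e = 0 \<Longrightarrow> \<exists>c. \<forall>A\<in>S. g A \<le> c * f A"
  shows "\<exists>C\<ge>0. \<forall>A\<in>S. (1 - e') * g A + e' * f A \<le> C * ((1 - e) * f A + e * g A)"
proof (cases "e = 0")
  case True
  then obtain c where c: "\<And>A. A \<in> S \<Longrightarrow> g A \<le> c * f A" using bounded by blast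
  have "(1 - e') * g A + e' * f A \<le> (\<bar>c\<bar> + 1) * f A" if A: "A \<in> S" for A
  proof -
    have "(1 - e') * g A \<le> 1 * g A" using e nonneg A by (intro mult_right_mono) auto
    moreover have "g A \<le> c * f A" using c A by simp
    moreover have "c * f A \<le> \<bar>c\<bar> * f A" using nonneg A by (intro mult_right_mono) auto
    moreover have "e' * f A \<le> 1 * f A" using e nonneg A by (intro mult_right_mono) auto
    ultimately show ?thesis unfolding distrib_right by linarith
  qed
  then show ?thesis using True by (intro exI[of _ "\<bar>c\<bar> + 1"]) auto
next
  case False
  with e have pos: "0 < e" "0 < 1 - e" by auto
  \<comment> \<open>With this constant both coefficients \<open>?C * e\<close> and
    \<open>?C * (1 - e)\<close> are at least 1.\<close>
  let ?C = "1 / e + 1 / (1 - e)"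
  have "?C * e = 1 + e / (1 - e)" "?C * (1 - e) = 1 + (1 - e) / e"
    using pos by (simp_all add: distrib_right)
  moreover have "0 \<le> e / (1 - e)" "0 \<le> (1 - e) / e" using pos by simp_all
  ultimately have C: "1 - e' \<le> ?C * e" "e' \<le> ?C * (1 - e)" using e by linarith+
  have "(1 - e') * g A + e' * f A \<le> ?C * ((1 - e) * f A + e * g A)" if A: "A \<in> S" for A
  proof -
    have "(1 - e') * g A \<le> (?C * e) * g A" "e' * f A \<le> (?C * (1 - e)) * f A"
      using C nonneg A by (intro mult_right_mono; simp)+
    then have "(1 - e') * g A + e' * f A \<le> (?C * (1 - e)) * f A + (?C * e) * g A" by linarith
    then show ?thesis by (simp only: distrib_left mult.assoc)
  qed
  moreover have "0 \<le> ?C" using pos by simp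
  ultimately show ?thesis by blast
qed

theorem theorem3:
  fixes M \<mu> P0 P1 :: "'y measure"
    and p0 p1 :: "'y \<Rightarrow> real"
    and \<pi>0 \<pi>1 e0 e1 :: real
    and eps0 eps1 :: "nat \<Rightarrow> real"
    and \<phi> :: "nat \<Rightarrow> nat \<Rightarrow> 'y \<Rightarrow> bool \<Rightarrow> bool"
  assumes "0 < \<pi>0" "\<pi>0 < 1" "0 < \<pi>1" "\<pi>1 < 1" "\<pi>0 + \<pi>1 = 1"
    and "P0 \<in> space (prob_algebra M)" "P1 \<in> space (prob_algebra M)"
    and "\<And>k. k \<ge> 1 \<Longrightarrow> 0 \<le> eps0 k \<and> eps0 k < 1"
    and "\<And>k. k \<ge> 1 \<Longrightarrow> 0 \<le> eps1 k \<and> eps1 k < 1"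
    and "\<And>k. k \<ge> 1 \<Longrightarrow>
           contamination_class M (eps0 k) P0 \<inter> contamination_class M (eps1 k) P1 = {}"
    and "\<And>k P Q. k \<ge> 1 \<Longrightarrow>
           P \<in> contamination_class M (eps0 k) P0 \<union> contamination_class M (eps1 k) P1 \<Longrightarrow>
           Q \<in> contamination_class M (eps0 k) P0 \<union> contamination_class M (eps1 k) P1 \<Longrightarrow>
           absolutely_continuous P Q"
    and "sets \<mu> = sets M"
    and "p0 \<in> borel_measurable M" "\<And>y. y \<in> space M \<Longrightarrow> 0 \<le> p0 y" "P0 = density \<mu> (\<lambda>y. ennreal (p0 y))"
    and "p1 \<in> borel_measurable M" "\<And>y. y \<in> space M \<Longrightarrow> 0 \<le> p1 y" "P1 = density \<mu> (\<lambda>y. ennreal (p1 y))"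
    and "\<And>k. k \<ge> 1 \<Longrightarrow> eps0 k = e0" "\<And>k. k \<ge> 1 \<Longrightarrow> eps1 k = e1"
    and "\<And>N. N \<ge> 1 \<Longrightarrow>
           is_arg_min (worst_error M \<pi>0 \<pi>1 eps0 eps1 P0 P1 N) (decision_rules M N) (\<phi> N)"
  shows "(\<lambda>N. worst_error M \<pi>0 \<pi>1 eps0 eps1 P0 P1 N (\<phi> N)) \<longlonglongrightarrow> 0 \<longleftrightarrow>
     (e0 = 0 \<and> ess_unbounded_above P0 (log_likelihood_ratio p1 p0)) \<or>
     (e1 = 0 \<and> ess_unbounded_below P0 (log_likelihood_ratio p1 p0))"
proof -
  note pi = assms(1-5) and prob = assms(6,7) and eps0 = assms(8) and eps1 = assms(9)
    and ac = assms(11) and \<mu> = assms(12) and p0 = assms(13-15) and p1 = assms(16-18)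
    and e0 = assms(19) and e1 = assms(20) and opt = assms(21)
  let ?W = "worst_error M \<pi>0 \<pi>1 eps0 eps1 P0 P1"
  let ?L = "log_likelihood_ratio p1 p0"
  have e01: "0 \<le> e0" "e0 < 1" "0 \<le> e1" "e1 < 1"
    using eps0[of 1] eps1[of 1] e0[of 1] e1[of 1] by auto
  have self: "P0 \<in> contamination_class M e P0" "P1 \<in> contamination_class M e P1" for e
    using prob by (auto intro: contamination_class_self)
  have ac01: "absolutely_continuous P0 P1" "absolutely_continuous P1 P0"
    using ac[of 1] self by blast+
  have pr: "prob_space P0" "prob_space P1" and sP: "sets P0 = sets P1"
    using prob by (auto simp: space_prob_algebra)
  \<comment> \<open>This turns the second condition into the first one with the hypotheses
    exchanged; \<open>P0\<close> and \<open>P1\<close> have the same null sets.\<close>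
  have below: "ess_unbounded_below P0 ?L \<longleftrightarrow> ess_unbounded_above P1 (log_likelihood_ratio p0 p1)"
  proof -
    have "(AE y in P0. R y) \<longleftrightarrow> (AE y in P1. R y)" for R
      using absolutely_continuous_AE[OF sP ac01(2)] absolutely_continuous_AE[OF sP[symmetric] ac01(1)]
      by blast
    then have "ess_unbounded_above P1 (\<lambda>y. - ?L y) = ess_unbounded_above P0 (\<lambda>y. - ?L y)"
      by (simp add: ess_unbounded_above_def)
    moreover have "log_likelihood_ratio p0 p1 = (\<lambda>y. - ?L y)"
      by (rule ext) (rule log_likelihood_ratio_flip)
    ultimately show ?thesis by (simp add: ess_unbounded_above_uminus)
  qed
  have W0: "0 \<le> ?W N \<psi>" for N \<psi>
    using pi prob by (intro worst_error_nonneg) auto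
  show ?thesis
  proof (rule iffI)
    assume lim: "(\<lambda>N. ?W N (\<phi> N)) \<longlonglongrightarrow> 0"
    show "(e0 = 0 \<and> ess_unbounded_above P0 ?L) \<or> (e1 = 0 \<and> ess_unbounded_below P0 ?L)"
    proof (rule ccontr)
      assume contra: "\<not> ?thesis"
      obtain Q0 where Q0: "Q0 \<in> contamination_class M e0 P0" "Q0 \<in> space (prob_algebra M)"
        "\<And>A. A \<in> sets M \<Longrightarrow> measure Q0 A = (1 - e0) * measure P0 A + e0 * measure P1 A"
        by (rule mixture_in_contamination_class[OF prob e01(1) _ \<mu> p0(1) p1(1) p0(3) p1(3)])
          (use e01 in auto)
      obtain Q1 where Q1: "Q1 \<in> contamination_class M e1 P1" "Q1 \<in> space (prob_algebra M)"
        "\<And>A. A \<in> sets M \<Longrightarrow> measure Q1 A = (1 - e1) * measure P1 A + e1 * measure P0 A"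
        by (rule mixture_in_contamination_class[OF prob(2,1) e01(3) _ \<mu> p1(1) p0(1) p1(3) p0(3)])
          (use e01 in auto)
      \<comment> \<open>Failure of the first condition bounds \<open>Q1\<close> by
        \<open>Q0\<close>; failure of the second one will give the reverse bound.\<close>
      have "\<exists>c. \<forall>A\<in>sets M. measure P1 A \<le> c * measure P0 A" if "e0 = 0"
        using ess_bounded_likelihood_ratio[OF prob ac01(1) \<mu> p0(1,3) p1(1,3)] contra that by metis
      from mixture_ratio_bounded[OF e01 _ _ this] obtain C1
        where C1: "0 \<le> C1" "\<And>A. A \<in> sets M \<Longrightarrow> measure Q1 A \<le> C1 * measure Q0 A"
        using Q0(3) Q1(3) by auto
      have "\<exists>c. \<forall>A\<in>sets M. measure P0 A \<le> c * measure P1 A" if "e1 = 0"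
        using ess_bounded_likelihood_ratio[OF prob(2,1) ac01(2) \<mu> p1(1,3) p0(1,3)] contra that below by metis
      from mixture_ratio_bounded[OF e01(3,4,1,2) _ _ this] obtain C0
        where C0: "0 \<le> C0" "\<And>A. A \<in> sets M \<Longrightarrow> measure Q0 A \<le> C0 * measure Q1 A"
        using Q0(3) Q1(3) by auto
      define C where "C = C0 + C1 + 2"
      have C: "1 < C" using C0 C1 by (simp add: C_def)
      have Q01: "measure Q0 A \<le> C * measure Q1 A" if "A \<in> sets M" for A
        using C0(2)[OF that] mult_right_mono[of C0 C "measure Q1 A"] C1(1)
        by (simp add: C_def)
      have Q10: "measure Q1 A \<le> C * measure Q0 A" if "A \<in> sets M" for A
        using C1(2)[OF that] mult_right_mono[of C1 C "measure Q0 A"] C0(1)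
        by (simp add: C_def)
      have "min \<pi>0 \<pi>1 / (C + 1) \<le> ?W N (\<phi> N)" if "1 \<le> N" for N
      proof (rule worst_error_ge[OF _ _ _ _ _ Q0(2) Q1(2) C Q01 Q10])
        show "decision_rules M N (\<phi> N)" using opt[OF that] by (simp add: is_arg_min_linorder)
      qed (use pi Q0(1) Q1(1) e0 e1 in auto)
      then have "min \<pi>0 \<pi>1 / (C + 1) \<le> 0"
        by (intro LIMSEQ_le_const[OF lim] exI[of _ 1]) auto
      moreover have "0 < min \<pi>0 \<pi>1 / (C + 1)" using pi C by simp
      ultimately show False by simp
    qed
  next
    assume cond: "(e0 = 0 \<and> ess_unbounded_above P0 ?L) \<or> (e1 = 0 \<and> ess_unbounded_below P0 ?L)"
    \<comment> \<open>Optimal rules need not be known: it is enough that some rules do well in every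
      tandem long enough to hold the \<open>n\<close> agents that may raise an alarm.\<close>
    have ex: "\<exists>n. \<forall>N\<ge>n. N \<ge> 1 \<longrightarrow> (\<exists>\<psi>. decision_rules M N \<psi> \<and> ?W N \<psi> \<le> \<delta>)" if \<delta>: "0 < \<delta>" for \<delta>
    proof -
      have conv: "\<pi>0 * x + \<pi>1 * y \<le> \<delta>" if "x \<le> \<delta>" "y \<le> \<delta>" for x y
        using convex_bound_le[OF that, of \<pi>0 \<pi>1] pi by simp
      show ?thesis using cond
      proof
        assume *: "e0 = 0 \<and> ess_unbounded_above P0 ?L"
        obtain A n where A: "A \<in> sets M" and bounds: "real n * measure P0 A \<le> \<delta>"
            "exp (- (real n * ((1 - e1) * measure P1 A))) \<le> \<delta>"
          by (rule exists_rare_event[OF prob \<mu> p0 p1 conjunct2[OF *] e01(4) \<delta>])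
        have "?W N (alarm_rule A n False) \<le> \<delta>" if N: "n \<le> N" "1 \<le> N" for N
        proof (rule worst_error_le[OF prob])
          fix Q0 Q1 assume Q: "Q0 \<in> uncertainty_product M eps0 P0 N" "Q1 \<in> uncertainty_product M eps1 P1 N"
          have "measure (PiM {1..N} Q0) {y \<in> space (PiM {1..N} Q0). \<exists>j\<in>{1..N}. j \<le> n \<and> y j \<in> A} \<le> \<delta>"
            using prob_alarm_uncontaminated[OF Q(1) _ pr(1) A N(1)] e0 * bounds(1) by fastforce
          moreover have "measure (PiM {1..N} Q1)
              {y \<in> space (PiM {1..N} Q1). \<not> (\<exists>j\<in>{1..N}. j \<le> n \<and> y j \<in> A)} \<le> \<delta>"
            using prob_no_alarm_contaminated[OF Q(2) _ e01(3) A N(1)] e1 bounds(2) by fastforce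
          ultimately show "error_prob \<pi>0 \<pi>1 N (alarm_rule A n False) Q0 Q1 \<le> \<delta>"
            unfolding error_prob_def decision_alarm_rule[OF N(2)] by (intro conv) auto
        qed
        then show ?thesis using decision_rules_alarm_rule[OF A] by blast
      next
        assume *: "e1 = 0 \<and> ess_unbounded_below P0 ?L"
        then have **: "ess_unbounded_above P1 (log_likelihood_ratio p0 p1)" using below by blast
        obtain A n where A: "A \<in> sets M" and bounds: "real n * measure P1 A \<le> \<delta>"
            "exp (- (real n * ((1 - e0) * measure P0 A))) \<le> \<delta>"
          by (rule exists_rare_event[OF prob(2,1) \<mu> p1 p0 ** e01(2) \<delta>])
        \<comment> \<open>Here an alarm speaks for the hypothesis 0, so the messages are
          \<open>True\<close> until one occurs, and a false alarm is an error under hypothesis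
          1.\<close>
        have "?W N (alarm_rule A n True) \<le> \<delta>" if N: "n \<le> N" "1 \<le> N" for N
        proof (rule worst_error_le[OF prob])
          fix Q0 Q1 assume Q: "Q0 \<in> uncertainty_product M eps0 P0 N" "Q1 \<in> uncertainty_product M eps1 P1 N"
          have "measure (PiM {1..N} Q1) {y \<in> space (PiM {1..N} Q1). \<exists>j\<in>{1..N}. j \<le> n \<and> y j \<in> A} \<le> \<delta>"
            using prob_alarm_uncontaminated[OF Q(2) _ pr(2) A N(1)] e1 * bounds(1) by fastforce
          moreover have "measure (PiM {1..N} Q0)
              {y \<in> space (PiM {1..N} Q0). \<not> (\<exists>j\<in>{1..N}. j \<le> n \<and> y j \<in> A)} \<le> \<delta>"
            using prob_no_alarm_contaminated[OF Q(1) _ e01(1) A N(1)] e0 bounds(2) by fastforce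
          ultimately show "error_prob \<pi>0 \<pi>1 N (alarm_rule A n True) Q0 Q1 \<le> \<delta>"
            unfolding error_prob_def decision_alarm_rule[OF N(2)] by (intro conv) auto
        qed
        then show ?thesis using decision_rules_alarm_rule[OF A] by blast
      qed
    qed
    show "(\<lambda>N. ?W N (\<phi> N)) \<longlonglongrightarrow> 0"
    proof (rule LIMSEQ_I)
      fix r :: real assume "0 < r"
      then obtain n where n: "\<And>N. n \<le> N \<Longrightarrow> 1 \<le> N \<Longrightarrow> \<exists>\<psi>. decision_rules M N \<psi> \<and> ?W N \<psi> \<le> r / 2"
        using ex[of "r / 2"] by auto
      have "norm (?W N (\<phi> N) - 0) < r" if "max n 1 \<le> N" for N
      proof -
        have "n \<le> N" "1 \<le> N" using that by auto
        from n[OF this] obtain \<psi> where "decision_rules M N \<psi>" "?W N \<psi> \<le> r / 2" by blast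
        then have "?W N (\<phi> N) \<le> r / 2"
          using opt[of N] that by (auto simp: is_arg_min_linorder intro: order_trans)
        then show ?thesis using W0[of N "\<phi> N"] \<open>0 < r\<close> by simp
      qed
      then show "\<exists>no. \<forall>N\<ge>no. norm (?W N (\<phi> N) - 0) < r" by blast
    qed
  qed
qed

end
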